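(* Let $S^*$ be a bottleneck server set and let $x^*$ be any optimal flow, i.e. any $x^*\in\mathcal X$ with $\max_{i\in\mathcal I}a_i(x^* )/\mu_i=\theta^*$. Then $$a_i(x^* )=\theta^*\mu_i,\qquad i\in S^*,$$ $$x_{ei}^*=0,\qquad e\in\mathcal E,\ e\not\subseteq S^*,\ i\in e\cap S^*.$$ Moreover, the family $\mathcal B^*$ is closed under union and intersection: if $S,T\in\mathcal B^*$, then $S\cup T\in\mathcal B^*$ and $S\cap T\in\mathcal B^*$. Thus the collection of bottleneck server sets has a unique maximal member, namely the union of all bottleneck server sets.
   Context: $\mathcal I=\{1,\dots,I\}$ is a finite nonempty set of servers; $\mathcal E$ is a finite set of nonempty subsets of $\mathcal I$ (hyperedges, representing overlapping service regions jointly served by the servers in $e$), with $e\not\subseteq e'$ for distinct $e,e'\in\mathcal E$. Given are primary arrival rates $\lambda_i\ge0$ ($i\in\mathcal I$), overlapping-region arrival rates $\lambda_e\ge0$ ($e\in\mathcal E$), and service rates $\mu_i>0$ ($i\in\mathcal I$). The hyperedge-flow polytope is $$\mathcal X:=\Big\{x=(x_{ei})_{e\in\mathcal E,\,i\in e}:\ x_{ei}\ge 0,\ \sum_{i\in e}x_{ei}=\lambda_e\ \ \forall e\in\mathcal E\Big\},$$ and for $x\in\mathcal X$, $a_i(x):=\lambda_i+\sum_{e\in\mathcal E:\,i\in e}x_{ei}$. For $S\subseteq\mathcal I$, $D(S):=\sum_{i\in S}\lambda_i+\sum_{e\in\mathcal E:\,e\subseteq S}\lambda_e$ and $M(S):=\sum_{i\in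 S}\mu_i$. The minimum achievable peak workload is $$\theta^*:=\min_{x\in\mathcal X}\max_{i\in\mathcal I}\frac{a_i(x)}{\mu_i}.$$ Define $\mathcal B^*:=\{S\subseteq\mathcal I: D(S)=\theta^*M(S)\}$ (the empty set is included). A bottleneck server set is a nonempty member of $\mathcal B^*$. (The paper shows that $\theta^*=\max_{\varnothing\ne S\subseteq\mathcal I}D(S)/M(S)$, so bottleneck server sets are exactly the nonempty sets attaining this maximum.) *)

theory Defs
  imports "HOL-Analysis.Analysis"
begin

text \<open>
  The servers are \<open>{1..n}\<close>. Primary arrival rates are \<open>lam i\<close>, arrival rates of the overlapping
  regions are \<open>lamE e\<close>, service rates are \<open>mu i\<close>, and the coordinate of a flow \<open>x\<close> indexed by a
  hyperedge \<open>e\<close> and a server \<open>i \<in> e\<close> is \<open>x e i\<close>. Extensional function spaces make the flows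
  correspond one-to-one to the families over these index pairs.
\<close>

definition flows :: "nat set set \<Rightarrow> (nat set \<Rightarrow> real) \<Rightarrow> (nat set \<Rightarrow> nat \<Rightarrow> real) set" where
  "flows E lamE = {x \<in> (\<Pi>\<^sub>E e\<in>E. \<Pi>\<^sub>E i\<in>e. {0..}). \<forall>e\<in>E. (\<Sum>i\<in>e. x e i) = lamE e}"

definition load :: "nat set set \<Rightarrow> (nat \<Rightarrow> real) \<Rightarrow> (nat set \<Rightarrow> nat \<Rightarrow> real) \<Rightarrow> nat \<Rightarrow> real" where
  "load E lam x i = lam i + (\<Sum>e\<in>{e\<in>E. i \<in> e}. x e i)"

definition demand :: "nat set set \<Rightarrow> (nat \<Rightarrow> real) \<Rightarrow> (nat set \<Rightarrow> real) \<Rightarrow> nat set \<Rightarrow> real" where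
  "demand E lam lamE S = (\<Sum>i\<in>S. lam i) + (\<Sum>e\<in>{e\<in>E. e \<subseteq> S}. lamE e)"

definition capacity :: "(nat \<Rightarrow> real) \<Rightarrow> nat set \<Rightarrow> real" where
  "capacity mu S = (\<Sum>i\<in>S. mu i)"

definition peak_workload ::
  "nat \<Rightarrow> nat set set \<Rightarrow> (nat \<Rightarrow> real) \<Rightarrow> (nat \<Rightarrow> real) \<Rightarrow> (nat set \<Rightarrow> nat \<Rightarrow> real) \<Rightarrow> real" where
  "peak_workload n E lam mu x = Max ((\<lambda>i. load E lam x i / mu i) ` {1..n})"

text \<open>
  \<open>Min\<close> is only meaningful for finite sets, so the minimum over the polytope is the least element
  of the set of attained values; lemma \<open>min_peak_workload_attained\<close> below shows that it exists.
\<close>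

definition min_peak_workload ::
  "nat \<Rightarrow> nat set set \<Rightarrow> (nat \<Rightarrow> real) \<Rightarrow> (nat set \<Rightarrow> real) \<Rightarrow> (nat \<Rightarrow> real) \<Rightarrow> real" where
  "min_peak_workload n E lam lamE mu = (LEAST t. t \<in> peak_workload n E lam mu ` flows E lamE)"

definition tight_sets ::
  "nat \<Rightarrow> nat set set \<Rightarrow> (nat \<Rightarrow> real) \<Rightarrow> (nat set \<Rightarrow> real) \<Rightarrow> (nat \<Rightarrow> real) \<Rightarrow> nat set set" where
  "tight_sets n E lam lamE mu =
     {S. S \<subseteq> {1..n} \<and> demand E lam lamE S = min_peak_workload n E lam lamE mu * capacity mu S}"

definition bottleneck_sets ::
  "nat \<Rightarrow> nat set set \<Rightarrow> (nat \<Rightarrow> real) \<Rightarrow> (nat set \<Rightarrow> real) \<Rightarrow> (nat \<Rightarrow> real) \<Rightarrow> nat set set" where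
  "bottleneck_sets n E lam lamE mu = {S \<in> tight_sets n E lam lamE mu. S \<noteq> {}}"

lemma compact_flows:
  assumes "\<forall>e\<in>E. finite e"
  shows "compact (flows E lamE)"
proof -
  define B where "B e = PiE UNIV (\<lambda>i. if i \<in> e then {0..lamE e} else {undefined})" for e
  define K where "K = PiE UNIV (\<lambda>e. if e \<in> E then B e else {undefined})"
  have cPi: "compact (PiE UNIV S)" if "\<And>i. compact (S i)"
    for S :: "'i \<Rightarrow> 'b::topological_space set"
    using that compactin_PiE[of "\<lambda>_. euclidean" UNIV S]
    by (simp add: euclidean_product_topology)
  have B: "compact (B e)" for e
    unfolding B_def by (rule cPi) auto
  have K: "compact K"
    unfolding K_def by (rule cPi) (auto simp: B)
  have cont: "continuous_on UNIV (\<lambda>x::nat set \<Rightarrow> nat \<Rightarrow> real. x e i)" for e i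
    by (rule continuous_on_product_then_coordinatewise[OF continuous_on_product_coordinates])
  have cl: "closed (\<Inter>e\<in>E. {x::nat set \<Rightarrow> nat \<Rightarrow> real. (\<Sum>i\<in>e. x e i) = lamE e})"
    by (intro closed_INT ballI closed_Collect_eq continuous_on_sum cont continuous_on_const)
  have "flows E lamE = K \<inter> (\<Inter>e\<in>E. {x. (\<Sum>i\<in>e. x e i) = lamE e})"
  proof (intro set_eqI iffI)
    fix x assume x: "x \<in> flows E lamE"
    have "x e i \<le> lamE e" if "e \<in> E" "i \<in> e" for e i
    proof -
      have "x e i \<le> (\<Sum>i\<in>e. x e i)"
        using x that assms by (intro member_le_sum) (auto simp: flows_def PiE_iff)
      then show ?thesis using x that by (simp add: flows_def)
    qed
    then show "x \<in> K \<inter> (\<Inter>e\<in>E. {x. (\<Sum>i\<in>e. x e i) = lamE e})"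
      using x by (auto simp: flows_def K_def B_def PiE_iff extensional_def)
  next
    fix x assume x: "x \<in> K \<inter> (\<Inter>e\<in>E. {x. (\<Sum>i\<in>e. x e i) = lamE e})"
    have xK: "x e \<in> (if e \<in> E then B e else {undefined})" for e
      using x unfolding K_def by (blast dest: PiE_mem)
    have xB: "x e i \<in> (if i \<in> e then {0..lamE e} else {undefined})" if "e \<in> E" for e i
      using xK[of e] that unfolding B_def by (auto dest!: PiE_mem[of _ _ _ i])
    have "x e i \<ge> 0" if "e \<in> E" "i \<in> e" for e i
      using xB[of e i] that by simp
    moreover have "x e i = undefined" if "e \<in> E" "i \<notin> e" for e i
      using xB[of e i] that by simp
    moreover have "x e = undefined" if "e \<notin> E" for e
      using xK[of e] that by simp
    moreover have "(\<Sum>i\<in>e. x e i) = lamE e" if "e \<in> E" for e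
      using x that by blast
    ultimately show "x \<in> flows E lamE"
      by (simp add: flows_def PiE_iff extensional_def)
  qed
  then show ?thesis using compact_Int_closed[OF K cl] by simp
qed

lemma flows_nonempty:
  assumes "\<forall>e\<in>E. finite e \<and> e \<noteq> {}" "\<forall>e\<in>E. lamE e \<ge> 0"
  shows "flows E lamE \<noteq> {}"
proof -
  define x where "x = (\<lambda>e\<in>E. \<lambda>i\<in>e. lamE e / card e)"
  have "(\<Sum>i\<in>e. x e i) = lamE e" if "e \<in> E" for e
  proof -
    have "card e > 0" using assms that by (simp add: card_gt_0_iff)
    then show ?thesis using that by (simp add: x_def)
  qed
  then have "x \<in> flows E lamE"
    using assms by (auto simp: flows_def x_def)
  then show ?thesis by blast
qed

lemma continuous_on_peak_workload:
  assumes "n \<ge> 1"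
  shows "continuous_on A (peak_workload n E lam mu)"
proof -
  have cont: "continuous_on A (\<lambda>x::nat set \<Rightarrow> nat \<Rightarrow> real. x e i)" for e i
    by (rule continuous_on_subset[OF
          continuous_on_product_then_coordinatewise[OF continuous_on_product_coordinates] subset_UNIV])
  have load: "continuous_on A (\<lambda>x. load E lam x i / mu i)" for i
    unfolding load_def divide_inverse by (intro continuous_intros cont)
  have "continuous_on A (\<lambda>x. Max ((\<lambda>i. load E lam x i / mu i) ` J))"
    if "finite J" "J \<noteq> {}" for J
    using that
    by (induction J rule: finite_ne_induct) (auto intro!: load continuous_on_max)
  then show ?thesis
    using assms unfolding peak_workload_def by simp
qed

lemma min_peak_workload_attained:
  assumes "n \<ge> 1" "\<forall>e\<in>E. e \<subseteq> {1..n} \<and> e \<noteq> {}" "\<forall>e\<in>E. lamE e \<ge> 0"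
  obtains x where "x \<in> flows E lamE"
    "peak_workload n E lam mu x = min_peak_workload n E lam lamE mu"
    "\<And>y. y \<in> flows E lamE \<Longrightarrow> peak_workload n E lam mu x \<le> peak_workload n E lam mu y"
proof -
  have fin: "\<forall>e\<in>E. finite e \<and> e \<noteq> {}"
    using assms(2) finite_subset by blast
  obtain x where x: "x \<in> flows E lamE"
    "\<forall>y\<in>flows E lamE. peak_workload n E lam mu x \<le> peak_workload n E lam mu y"
    using continuous_attains_inf[OF compact_flows flows_nonempty continuous_on_peak_workload]
      assms fin by metis
  then have "min_peak_workload n E lam lamE mu = peak_workload n E lam mu x"
    unfolding min_peak_workload_def by (intro Least_equality) auto
  then show ?thesis using x that by metis
qed

end

theory Submission
  imports Defs
begin

text \<open>
  For a flow \<open>x\<close> and a set \<open>S\<close> of servers, the total load on \<open>S\<close> is the demand of \<open>S\<close> plus the flow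
  that enters \<open>S\<close> from hyperedges not contained in \<open>S\<close>. If \<open>x\<close> is optimal, the total load is at most
  \<open>\<theta>\<^sup>* M(S)\<close>, so \<open>S\<close> is tight iff all its servers are saturated and no flow enters it from outside.
  The latter conditions are visibly stable under unions and intersections. A nonempty tight set is
  the set of saturated servers of an optimal flow that saturates as few servers as possible: if some
  flow entered this set from a hyperedge with an unsaturated server, shifting a little of it to that
  server would desaturate a server.
\<close>

section \<open>Total load of a set of servers, and bounds on the peak workload\<close>

lemma sum_load_eq:
  assumes "finite E" "\<forall>e\<in>E. finite e" "x \<in> flows E lamE" "finite S"
  shows "(\<Sum>i\<in>S. load E lam x i) =
    demand E lam lamE S + (\<Sum>e\<in>{e\<in>E. \<not> e \<subseteq> S}. \<Sum>i\<in>e \<inter> S. x e i)"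
proof -
  \<comment> \<open>Double counting: regrouped by hyperedge, the flow into \<open>S\<close>
    separates into hyperedges inside \<open>S\<close>, whose whole rate \<open>lamE e\<close> is
    served there, and the others.\<close>
  have "(\<Sum>i\<in>S. \<Sum>e\<in>{e\<in>E. i \<in> e}. x e i) = (\<Sum>e\<in>E. \<Sum>i\<in>{i\<in>S. i \<in> e}. x e i)"
    by (rule sum.swap_restrict) (use assms in auto)
  also have "\<dots> = (\<Sum>e\<in>E. \<Sum>i\<in>e \<inter> S. x e i)"
    by (intro sum.cong) auto
  also have "\<dots> = (\<Sum>e\<in>{e\<in>E. e \<subseteq> S} \<union> {e\<in>E. \<not> e \<subseteq> S}. \<Sum>i\<in>e \<inter> S. x e i)"
    by (intro sum.cong) auto
  also have "\<dots> = (\<Sum>e\<in>{e\<in>E. e \<subseteq> S}. \<Sum>i\<in>e \<inter> S. x e i) + (\<Sum>e\<in>{e\<in>E. \<not> e \<subseteq> S}. \<Sum>i\<in>e \<inter> S. x e i)"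
    by (intro sum.union_disjoint) (use assms in auto)
  also have "(\<Sum>e\<in>{e\<in>E. e \<subseteq> S}. \<Sum>i\<in>e \<inter> S. x e i) = (\<Sum>e\<in>{e\<in>E. e \<subseteq> S}. lamE e)"
    using assms(3) by (intro sum.cong) (auto simp: flows_def Int_absorb2)
  finally show ?thesis
    by (simp add: load_def demand_def sum.distrib)
qed

lemma peak_workload_le_iff:
  assumes "n \<ge> 1" "\<forall>i\<in>{1..n}. mu i > 0"
  shows "peak_workload n E lam mu x \<le> t \<longleftrightarrow> (\<forall>i\<in>{1..n}. load E lam x i \<le> t * mu i)"
  using assms by (simp add: peak_workload_def pos_divide_le_eq)

section \<open>Shifting flow between two servers of a hyperedge\<close>

definition shift_flow ::
  "nat set \<Rightarrow> nat \<Rightarrow> nat \<Rightarrow> real \<Rightarrow> (nat set \<Rightarrow> nat \<Rightarrow> real) \<Rightarrow> nat set \<Rightarrow> nat \<Rightarrow> real" where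
  "shift_flow e i j d x = x(e := (x e)(i := x e i - d, j := x e j + d))"

lemma shift_flow_in_flows:
  assumes "x \<in> flows E lamE" "e \<in> E" "finite e" "i \<in> e" "j \<in> e" "i \<noteq> j" "0 \<le> d" "d \<le> x e i"
  shows "shift_flow e i j d x \<in> flows E lamE"
proof -
  have nonneg: "\<forall>k\<in>e. 0 \<le> x e k" and sum: "(\<Sum>k\<in>e. x e k) = lamE e"
    using assms(1,2) by (auto simp: flows_def PiE_iff)
  \<comment> \<open>The two indicator terms sum to \<open>d\<close> each and cancel. This needs
    \<open>i \<noteq> j\<close>: both updates read the old \<open>x\<close>, so for
    \<open>i = j\<close> the outer one would just add \<open>d\<close>.\<close>
  have "(\<Sum>k\<in>e. shift_flow e i j d x e k)
      = (\<Sum>k\<in>e. x e k + ((if k = j then d else 0) - (if k = i then d else 0)))"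
    using \<open>i \<noteq> j\<close> by (intro sum.cong) (auto simp: shift_flow_def)
  also have "\<dots> = lamE e"
    using assms sum by (simp add: sum.distrib sum_subtractf)
  finally have "(\<Sum>k\<in>e. shift_flow e i j d x e k) = lamE e" .
  then show ?thesis
    using assms nonneg
    by (auto simp: flows_def PiE_iff extensional_def shift_flow_def)
qed

lemma load_shift_flow:
  assumes "finite E" "e \<in> E" "i \<in> e" "j \<in> e" "i \<noteq> j"
  shows "load E lam (shift_flow e i j d x) k =
    load E lam x k + (if k = j then d else if k = i then - d else 0)"
proof -
  let ?c = "if k = j then d else if k = i then - d else 0"
  have "(\<Sum>e'\<in>{e'\<in>E. k \<in> e'}. shift_flow e i j d x e' k)
      = (\<Sum>e'\<in>{e'\<in>E. k \<in> e'}. x e' k + (if e' = e then ?c else 0))"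
    using \<open>i \<noteq> j\<close> by (intro sum.cong) (auto simp: shift_flow_def)
  \<comment> \<open>If \<open>k\<close> is \<open>i\<close> or \<open>j\<close>, then
    \<open>e\<close> is among the summed hyperedges and contributes \<open>?c\<close>; for any other
    \<open>k\<close>, \<open>?c\<close> is 0.\<close>
  also have "\<dots> = (\<Sum>e'\<in>{e'\<in>E. k \<in> e'}. x e' k) + ?c"
    using assms by (auto simp: sum.distrib)
  finally show ?thesis by (simp add: load_def)
qed

section \<open>Optimal flows, their saturated servers, and tight sets\<close>

locale hyperedge_system =
  fixes n :: nat and E :: "nat set set"
    and lam :: "nat \<Rightarrow> real" and lamE :: "nat set \<Rightarrow> real" and mu :: "nat \<Rightarrow> real"
  assumes n_pos: "n \<ge> 1"
    and edges: "\<forall>e\<in>E. e \<subseteq> {1..n} \<and> e \<noteq> {}"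
    and lamE_nonneg: "\<forall>e\<in>E. lamE e \<ge> 0"
    and mu_pos: "\<forall>i\<in>{1..n}. mu i > 0"
begin

definition optimal :: "(nat set \<Rightarrow> nat \<Rightarrow> real) \<Rightarrow> bool" where
  "optimal x \<longleftrightarrow> x \<in> flows E lamE \<and> peak_workload n E lam mu x = min_peak_workload n E lam lamE mu"

definition saturated :: "(nat set \<Rightarrow> nat \<Rightarrow> real) \<Rightarrow> nat set" where
  "saturated x = {i\<in>{1..n}. load E lam x i = min_peak_workload n E lam lamE mu * mu i}"

lemma finite_edges: "finite E" and finite_edge: "\<forall>e\<in>E. finite e"
proof -
  show "finite E"
    by (rule finite_subset[of _ "Pow {1..n}"]) (use edges in auto)
  show "\<forall>e\<in>E. finite e"
    using edges finite_subset by blast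
qed

lemma min_peak_workload_le:
  assumes "x \<in> flows E lamE"
  shows "min_peak_workload n E lam lamE mu \<le> peak_workload n E lam mu x"
  using min_peak_workload_attained[OF n_pos edges lamE_nonneg] assms by metis

lemma optimal_exists: "\<exists>x. optimal x"
  using min_peak_workload_attained[OF n_pos edges lamE_nonneg] unfolding optimal_def by metis

text \<open>No flow has a peak below the minimum, so an upper bound already forces equality. This
  replaces the maximum of quotients by one linear inequality per server.\<close>

lemma optimal_iff:
  "optimal x \<longleftrightarrow> x \<in> flows E lamE \<and>
    (\<forall>i\<in>{1..n}. load E lam x i \<le> min_peak_workload n E lam lamE mu * mu i)"
  unfolding optimal_def peak_workload_le_iff[OF n_pos mu_pos, symmetric]
  using min_peak_workload_le by (metis order.antisym order_refl)

lemma saturated_nonempty: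
  assumes "optimal x"
  shows "saturated x \<noteq> {}"
proof -
  have "peak_workload n E lam mu x \<in> (\<lambda>i. load E lam x i / mu i) ` {1..n}"
    unfolding peak_workload_def using n_pos by (intro Max_in) auto
  then obtain i where "i \<in> {1..n}" "load E lam x i / mu i = min_peak_workload n E lam lamE mu"
    using assms by (auto simp: optimal_def)
  moreover have "mu i > 0"
    using \<open>i \<in> {1..n}\<close> mu_pos by blast
  ultimately have "i \<in> saturated x"
    by (auto simp: saturated_def field_simps)
  then show ?thesis by blast
qed

text \<open>The gap between \<open>\<theta> * M(S)\<close> and \<open>D(S)\<close> is the slack of
  the servers in \<open>S\<close> plus the inflow from outside. Both are sums of nonnegative terms,
  so the gap vanishes iff every term does. Since \<open>x\<close> is any optimal flow, this yields
  the claims about optimal flows; with one fixed \<open>x\<close>, it yields the closure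
  properties.\<close>

lemma tight_sets_iff:
  assumes "optimal x"
  shows "S \<in> tight_sets n E lam lamE mu \<longleftrightarrow>
    S \<subseteq> saturated x \<and> (\<forall>e\<in>E. \<not> e \<subseteq> S \<longrightarrow> (\<forall>i\<in>e \<inter> S. x e i = 0))"
proof (cases "S \<subseteq> {1..n}")
  case False
  then show ?thesis by (auto simp: tight_sets_def saturated_def)
next
  case True
  let ?\<theta> = "min_peak_workload n E lam lamE mu"
  let ?out = "\<lambda>e. \<Sum>i\<in>e \<inter> S. x e i"
  have fin: "finite S" using True finite_subset by blast
  have x: "x \<in> flows E lamE" and le: "\<forall>i\<in>{1..n}. load E lam x i \<le> ?\<theta> * mu i"
    using assms by (auto simp: optimal_iff)
  have nonneg: "x e i \<ge> 0" if "e \<in> E" "i \<in> e" for e i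
    using x that by (auto simp: flows_def PiE_iff)
  have slack: "(\<Sum>i\<in>S. ?\<theta> * mu i - load E lam x i) \<ge> 0"
    using le True by (intro sum_nonneg) auto
  have out: "(\<Sum>e\<in>{e\<in>E. \<not> e \<subseteq> S}. ?out e) \<ge> 0"
    by (intro sum_nonneg) (auto intro: nonneg)
  have "?\<theta> * capacity mu S - demand E lam lamE S =
      (\<Sum>i\<in>S. ?\<theta> * mu i - load E lam x i) + (\<Sum>e\<in>{e\<in>E. \<not> e \<subseteq> S}. ?out e)"
    using sum_load_eq[OF finite_edges finite_edge x fin, of lam]
    by (simp add: capacity_def sum_subtractf sum_distrib_left)
  then have "S \<in> tight_sets n E lam lamE mu \<longleftrightarrow>
      (\<Sum>i\<in>S. ?\<theta> * mu i - load E lam x i) = 0 \<and> (\<Sum>e\<in>{e\<in>E. \<not> e \<subseteq> S}. ?out e) = 0"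
    using True slack out unfolding tight_sets_def by auto
  also have "(\<Sum>i\<in>S. ?\<theta> * mu i - load E lam x i) = 0 \<longleftrightarrow> S \<subseteq> saturated x"
    using le True fin by (subst sum_nonneg_eq_0_iff) (auto simp: saturated_def)
  also have "(\<Sum>e\<in>{e\<in>E. \<not> e \<subseteq> S}. ?out e) = 0 \<longleftrightarrow> (\<forall>e\<in>{e\<in>E. \<not> e \<subseteq> S}. ?out e = 0)"
    using finite_edges by (intro sum_nonneg_eq_0_iff) (auto intro!: sum_nonneg nonneg)
  also have "\<dots> \<longleftrightarrow> (\<forall>e\<in>{e\<in>E. \<not> e \<subseteq> S}. \<forall>i\<in>e \<inter> S. x e i = 0)"
    using fin nonneg by (intro ball_cong refl sum_nonneg_eq_0_iff) auto
  finally show ?thesis by blast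
qed

text \<open>Ensures that the union of all bottleneck sets is nonempty, hence itself a bottleneck
  set.\<close>

lemma bottleneck_exists: "bottleneck_sets n E lam lamE mu \<noteq> {}"
proof -
  let ?\<theta> = "min_peak_workload n E lam lamE mu"
  obtain x where x: "optimal x" and least: "\<And>y. optimal y \<Longrightarrow> card (saturated x) \<le> card (saturated y)"
    using optimal_exists ex_has_least_nat[of optimal _ "\<lambda>x. card (saturated x)"] by blast
  have flow: "x \<in> flows E lamE" and le: "\<forall>i\<in>{1..n}. load E lam x i \<le> ?\<theta> * mu i"
    using x by (auto simp: optimal_iff)
  have "x e i = 0" if e: "e \<in> E" "\<not> e \<subseteq> saturated x" and i: "i \<in> e" "i \<in> saturated x" for e i
  proof (rule ccontr)
    assume "x e i \<noteq> 0"
    then have pos: "x e i > 0"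
      using flow e i by (fastforce simp: flows_def PiE_iff)
    obtain j where j: "j \<in> e" "j \<notin> saturated x"
      using e by blast
    then have "j \<in> {1..n}" "i \<noteq> j" "finite e"
      using edges e i finite_edge by blast+
    then have slack: "load E lam x j < ?\<theta> * mu j"
      using j le by (force simp: saturated_def)
    \<comment> \<open>The first bound keeps the flow from \<open>e\<close> to \<open>i\<close>
      nonnegative; half of the slack at \<open>j\<close> leaves \<open>j\<close> strictly
      unsaturated.\<close>
    define d where "d = min (x e i) ((?\<theta> * mu j - load E lam x j) / 2)"
    have d: "0 < d" "d \<le> x e i" "load E lam x j + d < ?\<theta> * mu j"
      using pos slack by (auto simp: d_def min_def field_simps)
    define y where "y = shift_flow e i j d x"
    have load_y: "load E lam y k = load E lam x k + (if k = j then d else if k = i then - d else 0)" for k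
      unfolding y_def using load_shift_flow finite_edges e i j \<open>i \<noteq> j\<close> by blast
    have "y \<in> flows E lamE"
      unfolding y_def using flow e i j d \<open>i \<noteq> j\<close> \<open>finite e\<close> by (intro shift_flow_in_flows) auto
    moreover have "load E lam y k \<le> ?\<theta> * mu k" if "k \<in> {1..n}" for k
      using le[rule_format, OF that] d by (auto simp: load_y)
    ultimately have "optimal y"
      by (simp add: optimal_iff)
    \<comment> \<open>Loads change only at \<open>i\<close> and \<open>j\<close>: \<open>i\<close>
      drops strictly below its bound and \<open>j\<close> stays below its own, so \<open>i\<close>
      is lost and nothing is gained.\<close>
    moreover have "k \<in> saturated x \<and> k \<noteq> i" if "k \<in> saturated y" for k
      using that d i \<open>i \<noteq> j\<close> by (auto simp: saturated_def load_y split: if_splits)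
    then have "saturated y \<subset> saturated x"
      using i by blast
    then have "card (saturated y) < card (saturated x)"
      by (intro psubset_card_mono) (auto simp: saturated_def)
    ultimately show False
      using least by fastforce
  qed
  then have "saturated x \<in> tight_sets n E lam lamE mu"
    by (auto simp: tight_sets_iff[OF x])
  then show ?thesis
    using saturated_nonempty[OF x] by (auto simp: bottleneck_sets_def)
qed

lemma tight_sets_Int:
  assumes "S \<in> tight_sets n E lam lamE mu" "T \<in> tight_sets n E lam lamE mu"
  shows "S \<inter> T \<in> tight_sets n E lam lamE mu"
proof -
  obtain x where "optimal x" using optimal_exists by blast
  \<comment> \<open>A hyperedge not inside \<open>S \<inter> T\<close> leaves \<open>S\<close> or
    \<open>T\<close>, and that set's inflow condition applies.\<close>
  then show ?thesis using assms by (auto simp: tight_sets_iff)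
qed

text \<open>Each server of the union lies in some member \<open>S\<close>, and a hyperedge not
  inside the union is not inside \<open>S\<close> either. Arbitrary families cover both the union of
  two sets and that of all bottleneck sets.\<close>

lemma tight_sets_Union:
  assumes "\<S> \<subseteq> tight_sets n E lam lamE mu"
  shows "\<Union>\<S> \<in> tight_sets n E lam lamE mu"
proof -
  obtain x where x: "optimal x" using optimal_exists by blast
  have "S \<subseteq> saturated x" "\<And>e i. e \<in> E \<Longrightarrow> \<not> e \<subseteq> S \<Longrightarrow> i \<in> e \<inter> S \<Longrightarrow> x e i = 0" if "S \<in> \<S>" for S
    using subsetD[OF assms that] by (auto simp: tight_sets_iff[OF x])
  then show ?thesis
    unfolding tight_sets_iff[OF x] by blast
qed

end

theorem corollary2:
  fixes n :: nat and E :: "nat set set"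
    and lam :: "nat \<Rightarrow> real" and lamE :: "nat set \<Rightarrow> real" and mu :: "nat \<Rightarrow> real"
  assumes "n \<ge> 1"
    and "\<forall>e\<in>E. e \<subseteq> {1..n} \<and> e \<noteq> {}"
    and "\<forall>e\<in>E. \<forall>e'\<in>E. e \<noteq> e' \<longrightarrow> \<not> e \<subseteq> e'"
    and "\<forall>i\<in>{1..n}. lam i \<ge> 0"
    and "\<forall>e\<in>E. lamE e \<ge> 0"
    and "\<forall>i\<in>{1..n}. mu i > 0"
  shows "(\<forall>S\<in>bottleneck_sets n E lam lamE mu. \<forall>x\<in>flows E lamE.
            peak_workload n E lam mu x = min_peak_workload n E lam lamE mu \<longrightarrow>
              (\<forall>i\<in>S. load E lam x i = min_peak_workload n E lam lamE mu * mu i) \<and>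
              (\<forall>e\<in>E. \<not> e \<subseteq> S \<longrightarrow> (\<forall>i\<in>e \<inter> S. x e i = 0)))
       \<and> (\<forall>S\<in>tight_sets n E lam lamE mu. \<forall>T\<in>tight_sets n E lam lamE mu.
            S \<union> T \<in> tight_sets n E lam lamE mu \<and> S \<inter> T \<in> tight_sets n E lam lamE mu)
       \<and> (\<exists>!U. U \<in> bottleneck_sets n E lam lamE mu \<and>
            (\<forall>S\<in>bottleneck_sets n E lam lamE mu. U \<subseteq> S \<longrightarrow> S = U))
       \<and> \<Union>(bottleneck_sets n E lam lamE mu) \<in> bottleneck_sets n E lam lamE mu \<and>
            (\<forall>S\<in>bottleneck_sets n E lam lamE mu.
               \<Union>(bottleneck_sets n E lam lamE mu) \<subseteq> S \<longrightarrow>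
                 S = \<Union>(bottleneck_sets n E lam lamE mu))"
proof -
  interpret hyperedge_system n E lam lamE mu
    using assms by unfold_locales
  let ?\<B> = "bottleneck_sets n E lam lamE mu" and ?\<T> = "tight_sets n E lam lamE mu"
  have sub: "?\<B> \<subseteq> ?\<T>" by (auto simp: bottleneck_sets_def)
  have Un: "\<Union>?\<B> \<in> ?\<B>"
    using tight_sets_Union[OF sub] bottleneck_exists by (auto simp: bottleneck_sets_def)
  have flows: "(\<forall>i\<in>S. load E lam x i = min_peak_workload n E lam lamE mu * mu i) \<and>
      (\<forall>e\<in>E. \<not> e \<subseteq> S \<longrightarrow> (\<forall>i\<in>e \<inter> S. x e i = 0))"
    if "S \<in> ?\<B>" "x \<in> flows E lamE"
      "peak_workload n E lam mu x = min_peak_workload n E lam lamE mu" for S x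
  proof -
    have "optimal x" using that by (simp add: optimal_def)
    then show ?thesis
      using subsetD[OF sub that(1)] by (auto simp: tight_sets_iff saturated_def)
  qed
  have tight: "S \<union> T \<in> ?\<T> \<and> S \<inter> T \<in> ?\<T>" if "S \<in> ?\<T>" "T \<in> ?\<T>" for S T
    using tight_sets_Union[of "{S, T}"] tight_sets_Int that by simp
  have max: "\<forall>S\<in>?\<B>. \<Union>?\<B> \<subseteq> S \<longrightarrow> S = \<Union>?\<B>"
    by blast
  have "\<exists>!U. U \<in> ?\<B> \<and> (\<forall>S\<in>?\<B>. U \<subseteq> S \<longrightarrow> S = U)"
  proof (rule ex1I)
    show "\<Union>?\<B> \<in> ?\<B> \<and> (\<forall>S\<in>?\<B>. \<Union>?\<B> \<subseteq> S \<longrightarrow> S = \<Union>?\<B>)"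
      using Un max by (rule conjI)
    \<comment> \<open>A maximal \<open>U\<close> is contained in the union, which is itself a
      bottleneck set, so maximality forces equality.\<close>
    show "U = \<Union>?\<B>" if "U \<in> ?\<B> \<and> (\<forall>S\<in>?\<B>. U \<subseteq> S \<longrightarrow> S = U)" for U
      using that Un Union_upper by metis
  qed
  then show ?thesis
    by (intro conjI ballI impI flows[THEN conjunct1, rule_format] flows[THEN conjunct2, rule_format]
        tight[THEN conjunct1] tight[THEN conjunct2] max[rule_format] Un)
qed

end
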